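(* Let $G^*:=\{z=x+iy:0<x<1,\ |y|<e^{-1/x}\}$ and let $m^*$ be the area measure (two-dimensional Lebesgue measure) supported on $\overline{G^*}$. Then for every $1\le p<\infty$ and every $k\in\mathbb{N}=\{1,2,\ldots\}$, $$\lim_{n\to\infty}\frac{\lambda_n(m^*,p,0)}{\rho_{1/n}(0)^k}=0,$$ where $\rho_{1/n}(0)$ is taken with respect to the domain $G^*$ (note $0\in\partial G^*$).
   Context: Let $\mathbb{P}_n$ be the set of complex polynomials of degree at most $n$. For a finite Borel measure $\nu$ on $\mathbb{C}$ with compact infinite support and $1\le p<\infty$, the $n$-th Christoffel function is $$\lambda_n(\nu,p,z):=\inf_{p_n\in\mathbb{P}_n,\ p_n(z)=1}\int|p_n|^p\,d\nu,\quad z\in\mathbb{C}.$$ For a bounded Jordan domain $G$ with boundary $L$, let $\overline{\mathbb{C}}=\mathbb{C}\cup\{\infty\}$, $\Omega:=\overline{\mathbb{C}}\setminus\overline{G}$, and let $\Phi$ be the Riemann mapping function of $\Omega$ onto the exterior of the closed unit disk in $\overline{\mathbb{C}}$ normalized by $\Phi(\infty)=\infty$ and $\lim_{z\to\infty}\Phi(z)/z>0$. For $\delta>0$ and $z\in L$ put $L_\delta:=\{\zeta\in\Omega:|\Phi(\zeta)|=1+\delta\}$ and $\rho_\delta(z):=\operatorname{dist}(z,L_\delta)=\inf_{\zeta\in L_\delta}|z-\zeta|$. Here these are used with $G=G^*$. *)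

theory Defs
  imports "HOL-Complex_Analysis.Complex_Analysis"
begin

definition christoffel :: "complex measure \<Rightarrow> real \<Rightarrow> nat \<Rightarrow> complex \<Rightarrow> real" where
  "christoffel \<nu> p n z =
     (INF P \<in> {P :: complex poly. degree P \<le> n \<and> poly P z = 1}.
        \<integral>w. norm (poly P w) powr p \<partial>\<nu>)"

text \<open>
  The Riemann map of the complement of \<open>closure G\<close> in the sphere onto the exterior of the
  closed unit disc is represented by its restriction to the finite points. The limit condition
  says that the extension sends infinity to infinity, is conformal there, and is normalized by
  a positive real derivative. Such a map is unique on \<open>- closure G\<close>; its values
  on \<open>closure G\<close> are unconstrained and never used.
\<close>
definition exterior_riemann_map :: "complex set \<Rightarrow> (complex \<Rightarrow> complex) \<Rightarrow> bool" where
  "exterior_riemann_map G \<Phi> \<longleftrightarrow>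
     \<Phi> holomorphic_on (- closure G) \<and>
     bij_betw \<Phi> (- closure G) {w. 1 < norm w} \<and>
     (\<exists>c::real. 0 < c \<and> ((\<lambda>z. \<Phi> z / z) \<longlongrightarrow> of_real c) at_infinity)"

definition level_curve :: "complex set \<Rightarrow> (complex \<Rightarrow> complex) \<Rightarrow> real \<Rightarrow> complex set" where
  "level_curve G \<Phi> \<delta> = {\<zeta>. \<zeta> \<notin> closure G \<and> norm (\<Phi> \<zeta>) = 1 + \<delta>}"

definition level_dist :: "complex set \<Rightarrow> (complex \<Rightarrow> complex) \<Rightarrow> real \<Rightarrow> complex \<Rightarrow> real" where
  "level_dist G \<Phi> \<delta> z = infdist z (level_curve G \<Phi> \<delta>)"

definition cusp_domain :: "complex set" where
  "cusp_domain = {z. 0 < Re z \<and> Re z < 1 \<and> \<bar>Im z\<bar> < exp (- (1 / Re z))}"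

definition cusp_measure :: "complex measure" where
  "cusp_measure = density lborel (indicator (closure cusp_domain))"

end

theory Submission
  imports Defs "HOL-Real_Asymp.Real_Asymp"
begin

text \<open>
  By the Schwarz lemma, the exterior map \<open>\<Phi>\<close> of any bounded domain whose closure contains
  \<open>[0, 1]\<close> is dominated in modulus by the exterior map of \<open>[0, 1]\<close>. This forces
  \<open>\<rho>\<^bsub>1/n\<^esub>(0) \<ge> 1 / (10 n\<^sup>2)\<close>. On the other hand the polynomials \<open>(1 - z/2)\<^sup>n\<close> are at most
  \<open>exp (-n Re z / 4)\<close> in modulus on the cusp; splitting the integral at \<open>Re z = 1 / \<surd>n\<close> and using
  that the tip beyond this line has area at most \<open>2 exp (-\<surd>n)\<close> bounds the Christoffel function
  by \<open>4 exp (-\<surd>n / 4)\<close>, which beats every power of \<open>n\<close>.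
\<close>

section \<open>Comparison of exterior maps\<close>

text \<open>Transported to the unit disc by w = 1 / \<open>\<Phi>\<close> z, the function
  \<open>f\<close> becomes a map of the disc into itself that fixes 0, so the Schwarz lemma bounds
  it by norm w.\<close>

lemma exterior_Schwarz:
  assumes \<Phi>: "exterior_riemann_map G \<Phi>" and G: "bounded G"
    and f: "f holomorphic_on - closure G" "\<And>z. z \<notin> closure G \<Longrightarrow> norm (f z) < 1"
    and f0: "(f \<longlongrightarrow> 0) at_infinity"
    and z: "z \<notin> closure G"
  shows "norm (f z) * norm (\<Phi> z) \<le> 1"
proof -
  from \<Phi> obtain c :: real where hol: "\<Phi> holomorphic_on (- closure G)"
    and bij: "bij_betw \<Phi> (- closure G) {w. 1 < norm w}"
    and c: "0 < c" "((\<lambda>z. \<Phi> z / z) \<longlongrightarrow> of_real c) at_infinity"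
    unfolding exterior_riemann_map_def by auto
  have im: "\<Phi> ` (- closure G) = {w. 1 < norm w}" and inj: "inj_on \<Phi> (- closure G)"
    using bij by (auto simp: bij_betw_def)
  obtain g where "g holomorphic_on \<Phi> ` (- closure G)"
    and g\<Phi>: "\<And>z. z \<in> - closure G \<Longrightarrow> g (\<Phi> z) = z"
    by (rule holomorphic_has_inverse[OF hol open_Compl[OF closed_closure] inj]) (rule that; simp)
  then have g: "g holomorphic_on {w. 1 < norm w}" by (simp add: im)
  have g_out: "g w \<notin> closure G" if "1 < norm w" for w
  proof -
    have "w \<in> \<Phi> ` (- closure G)" unfolding im using that by simp
    then show ?thesis using g\<Phi> by auto
  qed
  \<comment> \<open>The inversion moves infinity to 0, where \<open>K\<close> has an isolated
    singularity; it is removable because \<open>K\<close> is bounded by 1.\<close>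
  define K where "K w = f (g (1 / w))" for w
  have inv_out: "1 < norm (1 / w)" if "w \<in> ball 0 1 - {0::complex}" for w
    using that by (simp add: norm_divide)
  have inv: "(\<lambda>w. 1 / w) holomorphic_on ball 0 1 - {0::complex}"
    by (intro holomorphic_intros) auto
  have "(\<lambda>w. g (1 / w)) holomorphic_on ball 0 1 - {0}"
    by (rule holomorphic_on_compose_gen[OF inv g, unfolded o_def]) (use inv_out in blast)
  then have K: "K holomorphic_on ball 0 1 - {0}"
    unfolding K_def
    by (rule holomorphic_on_compose_gen[OF _ f(1), unfolded o_def]) (use inv_out g_out in blast)
  have K1: "norm (K w) < 1" if "w \<in> ball 0 1 - {0}" for w
    unfolding K_def using f(2) g_out inv_out that by blast
  have "eventually (\<lambda>w. norm (K w) \<le> 1) (at 0)"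
    unfolding eventually_at using K1 by (intro exI[of _ 1]) (force intro: less_imp_le)
  then obtain h where h: "h holomorphic_on ball 0 1"
    and hK: "\<And>w. w \<in> ball 0 1 - {0} \<Longrightarrow> h w = K w"
    using holomorphic_on_extend_bounded[OF K] by auto
  have ev_out: "eventually (\<lambda>z. z \<notin> closure G) at_infinity"
  proof -
    obtain B where "\<And>z. z \<in> closure G \<Longrightarrow> norm z \<le> B"
      using bounded_closure[OF G] by (auto simp: bounded_iff)
    then show ?thesis
      unfolding eventually_at_infinity by (intro exI[of _ "B + 1"]) force
  qed
  have h\<Phi>: "h (1 / \<Phi> z) = f z" if "z \<notin> closure G" for z
  proof -
    have "1 < norm (\<Phi> z)" using that im by blast
    then have "1 / \<Phi> z \<in> ball 0 1 - {0}" by (auto simp: norm_divide divide_less_eq_1)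
    then show ?thesis using hK that g\<Phi> by (simp add: K_def)
  qed
  \<comment> \<open>Writing 1 / \<open>\<Phi>\<close> z as (1 / z) times the reciprocal of
    \<open>\<Phi>\<close> z / z uses the normalization at infinity, with c \<noteq> 0. Hence
    \<open>f\<close> tends to both h 0 and 0, which identifies the extended value.\<close>
  have "((\<lambda>z. inverse z * inverse (\<Phi> z / z)) \<longlongrightarrow> 0 * inverse (of_real c)) at_infinity"
    using c by (intro tendsto_intros tendsto_inverse_0) auto
  moreover have "eventually (\<lambda>z. inverse z * inverse (\<Phi> z / z) = 1 / \<Phi> z) at_infinity"
    unfolding eventually_at_infinity by (intro exI[of _ 1]) (auto simp: field_simps)
  ultimately have "((\<lambda>z. 1 / \<Phi> z) \<longlongrightarrow> 0 * inverse (of_real c)) at_infinity"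
    by (rule Lim_transform_eventually)
  then have "((\<lambda>z. 1 / \<Phi> z) \<longlongrightarrow> 0) at_infinity" by simp
  moreover have "isCont h 0"
    using holomorphic_on_imp_continuous_on[OF h] continuous_on_eq_continuous_at[of "ball 0 1" h]
    by simp
  ultimately have "((\<lambda>z. h (1 / \<Phi> z)) \<longlongrightarrow> h 0) at_infinity"
    by (rule isCont_tendsto_compose[rotated])
  then have "(f \<longlongrightarrow> h 0) at_infinity"
    by (rule Lim_transform_eventually) (use ev_out h\<Phi> in \<open>auto elim: eventually_mono\<close>)
  then have h0: "h 0 = 0"
    using f0 tendsto_unique trivial_limit_at_infinity by blast
  have h1: "norm (h w) < 1" if "norm w < 1" for w
    using that h0 hK K1 by (cases "w = 0") auto
  have z1: "1 < norm (\<Phi> z)" using z im by blast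
  have "norm (h (1 / \<Phi> z)) \<le> norm (1 / \<Phi> z)"
    using z1 by (intro Schwarz_Lemma(1) h h0 h1) (auto simp: norm_divide divide_less_eq_1)
  moreover have "0 < norm (\<Phi> z)" using z1 by linarith
  ultimately show ?thesis
    using h\<Phi>[OF z] by (simp add: norm_divide pos_le_divide_eq)
qed

text \<open>If 1 - 1/z = r \<le> 0, then z = 1 / (1 - r). So the branch cut of \<open>csqrt\<close>
  pulls back into the segment [0, 1], and csqrt (1 - 1/z) is holomorphic off it.\<close>

lemma one_minus_inverse_nonpos_Reals:
  fixes z :: complex
  assumes "z \<noteq> 0" "1 - 1 / z \<in> \<real>\<^sub>\<le>\<^sub>0"
  shows "z \<in> of_real ` {0..1}"
proof -
  obtain r where r: "r \<le> 0" "1 - 1 / z = of_real r"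
    using assms(2) by (rule nonpos_Reals_cases)
  then have "1 / z = of_real (1 - r)"
    by (simp add: algebra_simps flip: r(2))
  then have "1 / (1 / z) = of_real (1 / (1 - r))"
    by (simp only: of_real_divide of_real_1)
  then have "z = of_real (1 / (1 - r))" by simp
  moreover have "1 / (1 - r) \<in> {0..1}" using r(1) by simp
  ultimately show ?thesis by blast
qed

text \<open>
  The competitor \<open>(1 - s) / (1 + s)\<close> with \<open>s = csqrt (1 - 1/z)\<close> is the reciprocal of the exterior
  map of \<open>[0, 1]\<close>.
\<close>
lemma norm_ge_on_level_curve:
  assumes \<Phi>: "exterior_riemann_map G \<Phi>" and G: "bounded G"
    and seg: "of_real ` {0..1} \<subseteq> closure G"
    and n: "1 \<le> n" and z: "z \<in> level_curve G \<Phi> (1 / real n)"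
  shows "1 / (10 * real n ^ 2) \<le> norm z"
proof -
  define s where "s z = csqrt (1 - 1 / z)" for z
  define f where "f z = (1 - s z) / (1 + s z)" for z
  have "0 \<in> closure G" using seg by force
  then have nz: "z \<noteq> 0" if "z \<notin> closure G" for z using that by auto
  have np: "1 - 1 / z \<notin> \<real>\<^sub>\<le>\<^sub>0" if "z \<notin> closure G" for z
    using one_minus_inverse_nonpos_Reals nz seg that by blast
  \<comment> \<open>The principal root has nonnegative real part, and a purely imaginary root would
    put its square on the branch cut.\<close>
  have Re_s: "0 < Re (s z)" if "z \<notin> closure G" for z
  proof (rule ccontr)
    assume "\<not> 0 < Re (s z)"
    then have "Re (s z) = 0" using Re_csqrt[of "1 - 1 / z"] by (simp add: s_def del: csqrt.sel)
    then have "s z = \<i> * of_real (Im (s z))" by (simp add: complex_eq_iff)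
    then have "s z ^ 2 = - of_real (Im (s z) ^ 2)"
      by (metis i_squared mult_minus1 of_real_power power_mult_distrib power2_eq_square)
    moreover have "s z ^ 2 = 1 - 1 / z" by (simp add: s_def)
    ultimately have "1 - 1 / z = of_real (- (Im (s z) ^ 2))" by simp
    moreover have "of_real (- (Im (s z) ^ 2)) \<in> (\<real>\<^sub>\<le>\<^sub>0 :: complex set)" by (subst nonpos_Reals_of_real_iff) simp
    ultimately show False using np[OF that] by metis
  qed
  have s_ne: "1 + s z \<noteq> 0" if "z \<notin> closure G" for z
    using Re_s[OF that] by (auto simp: complex_eq_iff)
  have "s holomorphic_on - closure G"
    unfolding s_def using np nz by (intro holomorphic_intros) auto
  then have "f holomorphic_on - closure G"
    unfolding f_def using s_ne by (intro holomorphic_intros) auto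
  moreover have "norm (f z) < 1" if "z \<notin> closure G" for z
  proof -
    \<comment> \<open>The two squared norms differ by 4 Re (s z), so the Cayley transform sends the
      right half-plane into the unit disc.\<close>
    have "norm (1 - s z) ^ 2 < norm (1 + s z) ^ 2"
      using Re_s[OF that] by (simp add: cmod_power2) (simp add: power2_eq_square algebra_simps)
    then have "norm (1 - s z) < norm (1 + s z)"
      by (rule power2_less_imp_less) simp
    then show ?thesis
      unfolding f_def using s_ne[OF that] by (simp add: norm_divide)
  qed
  moreover have "(f \<longlongrightarrow> 0) at_infinity"
  proof -
    have "((\<lambda>z::complex. 1 - inverse z) \<longlongrightarrow> 1 - 0) at_infinity"
      by (intro tendsto_intros tendsto_inverse_0)
    then have "((\<lambda>z. 1 - 1 / z) \<longlongrightarrow> (1::complex)) at_infinity"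
      by (simp add: inverse_eq_divide)
    then have "(s \<longlongrightarrow> csqrt 1) at_infinity"
      unfolding s_def
      by (intro isCont_tendsto_compose[where g = csqrt] continuous_at_csqrt) auto
    then have "(f \<longlongrightarrow> (1 - csqrt 1) / (1 + csqrt 1)) at_infinity"
      unfolding f_def by (intro tendsto_intros) auto
    then show ?thesis by simp
  qed
  moreover have z': "z \<notin> closure G" and \<Phi>z: "norm (\<Phi> z) = 1 + 1 / real n"
    using z by (auto simp: level_curve_def)
  ultimately have "norm (f z) * (1 + 1 / real n) \<le> 1"
    using exterior_Schwarz[OF \<Phi> G] by metis
  then have "norm (1 - s z) * (1 + 1 / real n) \<le> norm (1 + s z)"
    using s_ne[OF z'] by (simp add: f_def norm_divide field_simps)
  moreover have "(norm (s z) - 1) * (1 + 1 / real n) \<le> norm (1 - s z) * (1 + 1 / real n)"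
    using norm_triangle_ineq2[of "s z" 1]
    by (intro mult_right_mono) (auto simp: norm_minus_commute)
  moreover have "norm (1 + s z) \<le> 1 + norm (s z)"
    using norm_triangle_ineq[of 1 "s z"] by simp
  \<comment> \<open>Clearing denominators leaves norm (s z) / n \<le> 2 + 1/n. Squaring then gives 1
    / norm z \<le> 1 + 9 n^2, whence the constant 10.\<close>
  ultimately have "(norm (s z) - 1) * (1 + 1 / real n) \<le> 1 + norm (s z)" by linarith
  then have "norm (s z) \<le> 2 * real n + 1"
    using n by (simp add: field_simps)
  then have "norm (s z) \<le> 3 * real n" using n by linarith
  then have "norm (s z) ^ 2 \<le> (3 * real n) ^ 2"
    by (intro power_mono) auto
  moreover have "norm (s z) ^ 2 = norm (1 - 1 / z)"
    by (simp add: s_def flip: norm_power)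
  moreover have "norm (1 / z) - 1 \<le> norm (1 - 1 / z)"
    using norm_triangle_ineq2[of "1 / z" 1] by (simp add: norm_minus_commute)
  moreover have "1 \<le> real n ^ 2" using n by simp
  ultimately have "norm (1 / z) \<le> 10 * real n ^ 2"
    by (simp add: power_mult_distrib)
  then show ?thesis
    using nz[OF z'] n by (simp add: norm_divide field_simps)
qed

text \<open>\<open>infdist\<close> to the empty set is 0 by convention, so a positive lower bound
  for \<open>level_dist\<close> requires a point on the curve. Surjectivity of \<open>\<Phi>\<close>
  provides one.\<close>

lemma level_curve_nonempty:
  assumes "exterior_riemann_map G \<Phi>" "0 < \<delta>"
  shows "level_curve G \<Phi> \<delta> \<noteq> {}"
proof -
  have "norm (complex_of_real (1 + \<delta>)) = 1 + \<delta>"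
    using assms(2) by (subst norm_of_real) simp
  moreover have "\<Phi> ` (- closure G) = {w. 1 < norm w}"
    using assms(1) by (simp add: exterior_riemann_map_def bij_betw_def)
  ultimately obtain z where "z \<in> - closure G" "\<Phi> z = of_real (1 + \<delta>)"
    using assms(2) by (metis (mono_tags, lifting) imageE less_add_same_cancel1 mem_Collect_eq)
  then have "z \<in> level_curve G \<Phi> \<delta>"
    using \<open>norm (complex_of_real (1 + \<delta>)) = 1 + \<delta>\<close> by (simp only: level_curve_def) simp
  then show ?thesis by blast
qed

lemma level_dist_ge:
  assumes "exterior_riemann_map G \<Phi>" "bounded G" "of_real ` {0..1} \<subseteq> closure G" "1 \<le> n"
  shows "1 / (10 * real n ^ 2) \<le> level_dist G \<Phi> (1 / real n) 0"
proof -
  have ne: "level_curve G \<Phi> (1 / real n) \<noteq> {}"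
    using level_curve_nonempty[OF assms(1)] assms(4) by simp
  then show ?thesis
    unfolding level_dist_def infdist_notempty[OF ne]
    using norm_ge_on_level_curve[OF assms] by (intro cINF_greatest) auto
qed

section \<open>The cusp\<close>

lemma cusp_subset_cbox:
  "cusp_domain \<subseteq> cbox (Complex 0 (- 1)) (Complex 1 1)"
proof
  fix z assume "z \<in> cusp_domain"
  then have z: "0 < Re z" "Re z < 1" "\<bar>Im z\<bar> < exp (- (1 / Re z))"
    by (auto simp: cusp_domain_def)
  have "exp (- (1 / Re z)) \<le> 1" using z by simp
  then have "- 1 \<le> Im z" "Im z \<le> 1" using z by linarith+
  then show "z \<in> cbox (Complex 0 (- 1)) (Complex 1 1)"
    using z by (simp add: in_cbox_complex_iff)
qed

lemma bounded_cusp_domain: "bounded cusp_domain"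
  using bounded_subset[OF bounded_cbox cusp_subset_cbox] .

lemma unit_segment_subset_closure_cusp: "of_real ` {0..1} \<subseteq> closure cusp_domain"
proof -
  have "(of_real :: real \<Rightarrow> complex) ` closure {0<..<1} \<subseteq> closure (of_real ` {0<..<1})"
    by (intro image_closure_subset continuous_intros closure_subset closed_closure)
  also have "\<dots> \<subseteq> closure cusp_domain"
    by (intro closure_mono) (auto simp: cusp_domain_def)
  finally show ?thesis by simp
qed

text \<open>With t = 1/x this is 2 t \<le> exp t, which follows from the quadratic Taylor bound. The
  factor 1/2 keeps the cusp thin enough for the next estimate.\<close>

lemma exp_neg_inverse_le:
  assumes "0 < (x::real)" shows "exp (- (1 / x)) \<le> x / 2"
proof -
  define t where "t = 1 / x"
  have t: "0 < t" using assms by (simp add: t_def)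
  have "0 \<le> (t - 1)\<^sup>2" by simp
  then have "2 * t \<le> 1 + t + t\<^sup>2 / 2"
    using t by (simp add: power2_eq_square algebra_simps)
  also have "\<dots> \<le> exp t"
    using t exp_lower_Taylor_quadratic[of t] by simp
  finally have "2 * t \<le> exp t" .
  then have "inverse (exp t) \<le> inverse (2 * t)"
    using t by (intro le_imp_inverse_le) auto
  then show ?thesis by (simp add: t_def exp_minus)
qed

lemma norm_one_minus_half_le:
  assumes "z \<in> closure cusp_domain"
  shows "norm (1 - z / 2) \<le> 1 - Re z / 4"
proof -
  have "cusp_domain \<subseteq> {z. norm (1 - z / 2) \<le> 1 - Re z / 4}"
  proof clarify
    fix z assume "z \<in> cusp_domain"
    then have z: "0 < Re z" "Re z < 1" "\<bar>Im z\<bar> < exp (- (1 / Re z))"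
      by (auto simp: cusp_domain_def)
    \<comment> \<open>The real part gives 1 - Re z / 2, and the imaginary part costs at most Re z /
      4, leaving half of the gain.\<close>
    have "norm (1 - z / 2) \<le> \<bar>1 - Re z / 2\<bar> + \<bar>Im z / 2\<bar>"
      using cmod_le[of "1 - z / 2"] by simp
    then show "norm (1 - z / 2) \<le> 1 - Re z / 4"
      using z exp_neg_inverse_le[of "Re z"] by auto
  qed
  moreover have "closed {z. norm (1 - z / 2) \<le> 1 - Re z / 4}"
    by (intro closed_Collect_le continuous_intros) auto
  ultimately show ?thesis
    using closure_minimal assms by blast
qed

text \<open>Points of the cusp with real part below r have height at most exp (-1/r) by
  monotonicity. Adding the half-plane Re z \<ge> r makes the covering set closed, so the inclusion
  passes to the closure.\<close>

lemma closure_cusp_tip: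
  assumes "z \<in> closure cusp_domain" "Re z < r"
  shows "z \<in> cbox (Complex 0 (- exp (- (1 / r)))) (Complex 1 (exp (- (1 / r))))"
proof -
  let ?B = "cbox (Complex 0 (- exp (- (1 / r)))) (Complex 1 (exp (- (1 / r))))"
  have "cusp_domain \<subseteq> {z. r \<le> Re z} \<union> ?B"
  proof
    fix z assume "z \<in> cusp_domain"
    then have z: "0 < Re z" "Re z < 1" "\<bar>Im z\<bar> < exp (- (1 / Re z))"
      by (auto simp: cusp_domain_def)
    show "z \<in> {z. r \<le> Re z} \<union> ?B"
    proof (cases "r \<le> Re z")
      case False
      then have "exp (- (1 / Re z)) \<le> exp (- (1 / r))"
        using z by (simp add: frac_le)
      then have "- exp (- (1 / r)) \<le> Im z" "Im z \<le> exp (- (1 / r))"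
        using z by linarith+
      then show ?thesis using z by (simp add: in_cbox_complex_iff)
    qed simp
  qed
  moreover have "closed ({z. r \<le> Re z} \<union> ?B)"
    by (intro closed_Un closed_cbox closed_halfspace_Re_ge)
  ultimately have "z \<in> {z. r \<le> Re z} \<union> ?B"
    using closure_minimal assms(1) by blast
  then show ?thesis using assms(2) by auto
qed

lemma measure_cbox_strip:
  assumes "0 \<le> b"
  shows "measure lborel (cbox (Complex 0 (- b)) (Complex 1 b)) = 2 * b"
  using assms by (simp add: measure_lborel_cbox_eq Basis_complex_def inner_complex_def)

section \<open>Bounds for the Christoffel function\<close>

lemma christoffel_nonneg:
  "0 \<le> christoffel \<nu> p n z"
  unfolding christoffel_def
proof (rule cINF_greatest)
  have "(1 :: complex poly) \<in> {P. degree P \<le> n \<and> poly P z = 1}" by simp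
  then show "{P :: complex poly. degree P \<le> n \<and> poly P z = 1} \<noteq> {}" by blast
qed (simp add: integral_nonneg_AE)

lemma christoffel_le:
  assumes "degree P \<le> n" "poly P z = 1"
  shows "christoffel \<nu> p n z \<le> (\<integral>w. norm (poly P w) powr p \<partial>\<nu>)"
  unfolding christoffel_def using assms
  by (intro cINF_lower bdd_belowI[of _ 0]) (auto simp: integral_nonneg_AE)

lemma christoffel_cusp_le:
  assumes p: "1 \<le> p" and n: "1 \<le> n"
  shows "christoffel cusp_measure p n 0 \<le> 4 * exp (- (sqrt (real n) / 4))"
proof -
  define P :: "complex poly" where "P = [:1, - (1 / 2):] ^ n"
  define r where "r = 1 / sqrt (real n)"
  define E where "E = exp (- (sqrt (real n) / 4))"
  define strip where "strip b = cbox (Complex 0 (- b)) (Complex 1 b)" for b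
  \<comment> \<open>Integrable majorant: the first strip covers the tip, where the polynomial is
    bounded by 1; on the rest of the cusp it is at most \<open>E\<close>, and strip 1 contains the
    whole closure.\<close>
  define u where "u z = indicat_real (strip (exp (- (1 / r)))) z + E * indicat_real (strip 1) z" for z
  have P: "poly P z = (1 - z / 2) ^ n" for z
    by (simp add: P_def poly_power)
  have "degree P \<le> n"
    unfolding P_def using degree_power_le[of "[:1, - (1 / 2):] :: complex poly" n] by simp
  then have "christoffel cusp_measure p n 0 \<le> (\<integral>w. norm (poly P w) powr p \<partial>cusp_measure)"
    by (intro christoffel_le) (auto simp: P)
  also have "\<dots> = (\<integral>w. indicat_real (closure cusp_domain) w * norm (poly P w) powr p \<partial>lborel)"
  proof -
    have [measurable]: "closure cusp_domain \<in> sets borel" by simp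
    have "continuous_on UNIV (\<lambda>w. norm (poly P w))"
      by (intro continuous_intros)
    then have [measurable]: "(\<lambda>w. norm (poly P w)) \<in> borel_measurable borel"
      by (rule borel_measurable_continuous_onI)
    \<comment> \<open>The real-valued form of the indicator matches the shape expected by
      \<open>integral_density\<close>.\<close>
    have eq: "cusp_measure = density lborel (\<lambda>w. ennreal (indicat_real (closure cusp_domain) w))"
      by (simp add: cusp_measure_def ennreal_indicator)
    show ?thesis unfolding eq by (subst integral_density) auto
  qed
  also have "\<dots> \<le> (\<integral>w. u w \<partial>lborel)"
  proof (rule integral_mono')
    show "integrable lborel u"
      unfolding u_def strip_def by (intro Bochner_Integration.integrable_add integrable_mult_right
        integrable_real_indicator) (auto simp: emeasure_lborel_cbox_eq)
    show "0 \<le> u w" for w by (simp add: u_def E_def)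
    show "indicat_real (closure cusp_domain) w * norm (poly P w) powr p \<le> u w" for w
    proof (cases "w \<in> closure cusp_domain")
      case True
      have strip1: "w \<in> strip 1"
        unfolding strip_def using True closure_minimal[OF cusp_subset_cbox closed_cbox] by blast
      then have Re: "0 \<le> Re w" "Re w \<le> 1" by (auto simp: strip_def in_cbox_complex_iff)
      have half: "norm (1 - w / 2) \<le> 1 - Re w / 4"
        using norm_one_minus_half_le[OF True] .
      have P_le: "norm (poly P w) \<le> (1 - Re w / 4) ^ n"
        unfolding P norm_power using half by (intro power_mono) auto
      also have "\<dots> \<le> 1" using Re by (intro power_le_one) auto
      finally have P1: "norm (poly P w) \<le> 1" .
      \<comment> \<open>For a base at most 1, raising the exponent from 1 to p only decreases the
        value, so the bound is uniform in p.\<close>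
      then have "norm (poly P w) powr p \<le> norm (poly P w) powr 1"
        using p by (intro powr_mono') auto
      then have powr_le: "norm (poly P w) powr p \<le> norm (poly P w)" by simp
      show ?thesis
      proof (cases "Re w < r")
        case below: True
        then have "w \<in> strip (exp (- (1 / r)))"
          unfolding strip_def by (rule closure_cusp_tip[OF True])
        moreover have "0 \<le> E * indicat_real (strip 1) w" by (simp add: E_def)
        ultimately show ?thesis
          using True powr_le P1 by (simp add: u_def)
      next
        case False
        have "(1 - Re w / 4) ^ n \<le> exp (- (Re w / 4)) ^ n"
          using Re exp_ge_add_one_self[of "- (Re w / 4)"] by (intro power_mono) auto
        also have "\<dots> = exp (- (real n * Re w / 4))"
          by (simp flip: exp_of_nat_mult)
        also have "\<dots> \<le> E"
        proof -
          \<comment> \<open>The cut r = 1 / sqrt n balances both pieces: n r and 1/r both equal sqrt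
            n.\<close>
          have "sqrt (real n) = real n * r"
            using n by (simp add: r_def real_div_sqrt)
          also have "\<dots> \<le> real n * Re w"
            using False by (intro mult_left_mono) auto
          finally show ?thesis by (simp add: E_def)
        qed
        finally have "norm (poly P w) \<le> E" using P_le by linarith
        then show ?thesis
          using True powr_le strip1 by (simp add: u_def add_increasing)
      qed
    qed (simp add: u_def E_def)
  qed
  also have "\<dots> = 2 * exp (- sqrt (real n)) + E * 2"
  proof -
    have int: "integrable lborel (indicat_real (strip b))" for b
      by (intro integrable_real_indicator) (auto simp: strip_def emeasure_lborel_cbox_eq)
    have "(\<integral>w. u w \<partial>lborel) = measure lborel (strip (exp (- (1 / r)))) + E * measure lborel (strip 1)"
      unfolding u_def using int by simp
    then show ?thesis
      by (simp add: strip_def measure_cbox_strip r_def)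
  qed
  also have "exp (- sqrt (real n)) \<le> E"
    unfolding E_def by simp
  finally show ?thesis by (simp add: E_def)
qed

theorem theorem2:
  fixes \<Phi> :: "complex \<Rightarrow> complex" and p :: real and k :: nat
  assumes "exterior_riemann_map cusp_domain \<Phi>"
    and "1 \<le> p"
    and "1 \<le> k"
  shows "(\<lambda>n::nat. christoffel cusp_measure p n 0 / level_dist cusp_domain \<Phi> (1 / real n) 0 ^ k)
           \<longlonglongrightarrow> 0"
proof (rule tendsto_sandwich)
  let ?c = "\<lambda>n. christoffel cusp_measure p n 0"
  let ?d = "\<lambda>n. level_dist cusp_domain \<Phi> (1 / real n) 0"
  \<comment> \<open>The numerator bound divided by the k-th power of the lower bound 1 / (10 n^2);
    the exponential in sqrt n beats every fixed power of n.\<close>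
  let ?E = "\<lambda>n. 4 * exp (- (sqrt (real n) / 4)) * (10 * real n ^ 2) ^ k"
  show "eventually (\<lambda>n. 0 \<le> ?c n / ?d n ^ k) sequentially"
    by (simp add: level_dist_def infdist_nonneg christoffel_nonneg)
  show "eventually (\<lambda>n. ?c n / ?d n ^ k \<le> ?E n) sequentially"
  proof (rule eventually_sequentiallyI)
    fix n :: nat assume n: "1 \<le> n"
    have "(1 / (10 * real n ^ 2)) ^ k \<le> ?d n ^ k"
      using level_dist_ge[OF assms(1) bounded_cusp_domain unit_segment_subset_closure_cusp n]
      by (intro power_mono) auto
    then have "?c n / ?d n ^ k \<le> 4 * exp (- (sqrt (real n) / 4)) / (1 / (10 * real n ^ 2)) ^ k"
      using christoffel_cusp_le[OF assms(2) n] n by (intro frac_le) auto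
    then show "?c n / ?d n ^ k \<le> ?E n" by (simp add: power_one_over)
  qed
  show "?E \<longlonglongrightarrow> 0"
    by real_asymp
qed auto

end
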